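(* Let $q$ be a prime power, let $n$ be a positive integer, and let $F_q$ be the field with $q$ elements. Let $k$ be a positive integer and let $\mathcal{F} \subseteq \mathrm{sub}(F_q^n)$ be a family of subspaces such that $\dim(A \cap B) = k$ for all $A, B \in \mathcal{F}$ with $A \neq B$. Then $|\mathcal{F}| \leq [n]_q$.
   Context: $\mathrm{sub}(F_q^n)$ denotes the set of all linear subspaces of the $n$-dimensional vector space $F_q^n$ over $F_q$. For a positive integer $n$, $[n]_q := \frac{1-q^n}{1-q} = 1 + q + q^2 + \cdots + q^{n-1}$. *)

theory Defs
  imports "HOL-Analysis.Analysis" "HOL-Number_Theory.Prime_Powers"
begin

text \<open>Constants qualified by \<open>vec\<close> come from the library's interpretation of vector spaces for
  \<open>'a ^ 'n\<close> with scalar multiplication \<open>(*s)\<close> over an arbitrary field \<open>'a\<close>; the unqualified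
  \<open>subspace\<close> and \<open>dim\<close> would refer to real vector spaces.\<close>

definition sub :: "('a::field ^ 'n) set set" where
  "sub = {S. vec.subspace S}"

definition q_bracket :: "nat \<Rightarrow> nat \<Rightarrow> real" where
  "q_bracket q n = (1 - real q ^ n) / (1 - real q)"

lemma q_bracket_eq_sum:
  assumes "q \<noteq> 1"
  shows "q_bracket q n = (\<Sum>i<n. real q ^ i)"
  using assms by (simp add: q_bracket_def sum_gp_strict)

end

theory Submission
  imports Defs
begin

text \<open>Replace each subspace by the set of lines it contains. Two distinct members of the family
  share equally many lines, and at least one since \<open>k > 0\<close>; there are \<open>[n]\<^sub>q\<close> lines in total.
  The bound is then the nonuniform Fisher inequality: if there were more sets \<open>A\<close> than points,
  their indicator vectors would satisfy a nontrivial relation with coefficients \<open>c A\<close>, whose squared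
  norm is \<open>l (\<Sum>A. c A)\<^sup>2 + (\<Sum>A. (card A - l) (c A)\<^sup>2)\<close>, where at most one \<open>card A - l\<close> can vanish.\<close>

section \<open>Linear dependence and the nonuniform Fisher inequality\<close>

text \<open>Gaussian elimination, one equation of \<open>X\<close> at a time: an equation with zero
  coefficients is dropped, any other serves to eliminate an unknown \<open>j\<close>, so that
  equations and unknowns both decrease by one.\<close>

lemma underdetermined_system_has_nontrivial_solution:
  fixes a :: "'i \<Rightarrow> 'x \<Rightarrow> 'b::field"
  assumes "finite X" "finite I" "card X < card I"
  shows "\<exists>c. (\<exists>i\<in>I. c i \<noteq> 0) \<and> (\<forall>x\<in>X. (\<Sum>i\<in>I. c i * a i x) = 0)"
  using assms
proof (induction X arbitrary: I a rule: finite_induct)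
  case empty
  then have "I \<noteq> {}" by auto
  then show ?case by (intro exI[of _ "\<lambda>_. 1"]) auto
next
  case (insert x X)
  show ?case
  proof (cases "\<forall>i\<in>I. a i x = 0")
    case True
    have "card X < card I" using insert by simp
    from insert.IH[OF insert.prems(1) this, of a] show ?thesis using True by simp
  next
    case False
    then obtain j where j: "j \<in> I" "a j x \<noteq> 0" by blast
    have "card X < card (I - {j})" using insert j by simp
    from insert.IH[OF _ this, of "\<lambda>i y. a i y - (a i x / a j x) * a j y"] insert.prems(1)
    obtain c i where i: "i \<in> I - {j}" "c i \<noteq> 0"
      and c: "\<And>y. y \<in> X \<Longrightarrow> (\<Sum>i\<in>I-{j}. c i * (a i y - (a i x / a j x) * a j y)) = 0"
      by auto
    \<comment> \<open>The value at \<open>j\<close> is the one forced by equation \<open>x\<close>.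
      With it every original equation agrees with its reduced form, and the reduced form of
      \<open>x\<close> itself has only zero coefficients.\<close>
    define d where "d = c(j := - (\<Sum>i\<in>I-{j}. c i * (a i x / a j x)))"
    have d: "(\<Sum>i\<in>I. d i * a i y) = (\<Sum>i\<in>I-{j}. c i * (a i y - (a i x / a j x) * a j y))" for y
    proof -
      have "(\<Sum>i\<in>I. d i * a i y) = d j * a j y + (\<Sum>i\<in>I-{j}. c i * a i y)"
        unfolding sum.remove[OF insert.prems(1) j(1), of "\<lambda>i. d i * a i y"]
        by (intro arg_cong2[of _ _ _ _ "(+)"] sum.cong refl) (simp add: d_def)
      then show ?thesis
        by (simp add: d_def sum_subtractf sum_distrib_right right_diff_distrib mult.assoc)
    qed
    have "(\<Sum>i\<in>I. d i * a i y) = 0" if "y \<in> insert x X" for y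
    proof (cases "y = x")
      case True
      then show ?thesis unfolding d using j by simp
    next
      case False
      then show ?thesis unfolding d using c that by simp
    qed
    moreover have "d i \<noteq> 0" using i by (auto simp: d_def)
    ultimately show ?thesis using i by blast
  qed
qed

text \<open>The product of two indicators is the indicator of the intersection, so the Gram matrix
  of the indicator vectors consists of the intersection sizes.\<close>

lemma sum_sq_indicator_combination:
  fixes c :: "'x set \<Rightarrow> real"
  assumes "finite X" "\<And>A. A \<in> S \<Longrightarrow> A \<subseteq> X"
  shows "(\<Sum>x\<in>X. (\<Sum>A\<in>S. c A * indicator A x)\<^sup>2)
    = (\<Sum>A\<in>S. \<Sum>B\<in>S. c A * c B * card (A \<inter> B))"
proof -
  have "(\<Sum>x\<in>X. (\<Sum>A\<in>S. c A * indicator A x)\<^sup>2)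
      = (\<Sum>x\<in>X. \<Sum>A\<in>S. \<Sum>B\<in>S. c A * c B * indicator (A \<inter> B) x)"
    by (simp add: power2_eq_square sum_product indicator_inter_arith mult_ac)
  also have "\<dots> = (\<Sum>A\<in>S. \<Sum>x\<in>X. \<Sum>B\<in>S. c A * c B * indicator (A \<inter> B) x)"
    by (rule sum.swap)
  also have "\<dots> = (\<Sum>A\<in>S. \<Sum>B\<in>S. \<Sum>x\<in>X. c A * c B * indicator (A \<inter> B) x)"
    by (intro sum.cong refl sum.swap)
  also have "\<dots> = (\<Sum>A\<in>S. \<Sum>B\<in>S. c A * c B * card (A \<inter> B))"
  proof (intro sum.cong refl)
    fix A B assume "A \<in> S" "B \<in> S"
    then have "{x \<in> X. x \<in> A \<inter> B} = A \<inter> B" using assms by blast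
    then show "(\<Sum>x\<in>X. c A * c B * indicator (A \<inter> B) x) = c A * c B * card (A \<inter> B)"
      using sum_mult_indicator[OF assms(1), of "\<lambda>_. c A * c B" "\<lambda>_. A \<inter> B" "\<lambda>x. x"] by (simp del: Int_iff)
  qed
  finally show ?thesis .
qed

text \<open>Assumption \<open>two\<close> gives each member a partner, whence
  \<open>l \<le> card A\<close>; it also excludes \<open>S = {{}}\<close> with
  \<open>X = {}\<close>, where the bound fails.\<close>

theorem nonuniform_fisher_inequality:
  assumes "finite X" "\<And>A. A \<in> S \<Longrightarrow> A \<subseteq> X" "l > 0"
    and l: "\<And>A B. A \<in> S \<Longrightarrow> B \<in> S \<Longrightarrow> A \<noteq> B \<Longrightarrow> card (A \<inter> B) = l"
    and two: "1 < card S"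
  shows "card S \<le> card X"
proof (rule ccontr)
  assume "\<not> card S \<le> card X"
  moreover have fS: "finite S" using two by (intro card_ge_0_finite) linarith
  ultimately obtain c :: "'a set \<Rightarrow> real" where nz: "\<exists>A\<in>S. c A \<noteq> 0"
    and c: "\<And>x. x \<in> X \<Longrightarrow> (\<Sum>A\<in>S. c A * indicator A x) = 0"
    using underdetermined_system_has_nontrivial_solution[OF assms(1) fS, of indicator] by auto
  have fin: "finite A" if "A \<in> S" for A using assms(1,2) that finite_subset by blast
  have ge: "l \<le> card A" if "A \<in> S" for A
  proof -
    have "\<not> S \<subseteq> {A}" using two card_mono[of "{A}" S] by auto
    then obtain B where "B \<in> S" "A \<noteq> B" by blast
    then show ?thesis using l[OF that] card_mono[OF fin[OF that], of "A \<inter> B"] by fastforce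
  qed
  have "0 = (\<Sum>A\<in>S. \<Sum>B\<in>S. c A * c B * card (A \<inter> B))"
    using sum_sq_indicator_combination[OF assms(1,2), where S = S and c = c] c by simp
  \<comment> \<open>The Gram matrix is \<open>l\<close> times the all-ones matrix plus a diagonal
    matrix with entries \<open>card A - l\<close>.\<close>
  also have "\<dots> = (\<Sum>A\<in>S. \<Sum>B\<in>S. l * (c A * c B)
      + (if A = B then (card A - real l) * (c A)\<^sup>2 else 0))"
    by (intro sum.cong refl) (auto simp: l power2_eq_square algebra_simps)
  also have "\<dots> = l * (\<Sum>A\<in>S. c A)\<^sup>2 + (\<Sum>A\<in>S. (card A - real l) * (c A)\<^sup>2)"
    unfolding power2_eq_square sum_product sum.distrib unfolding sum_distrib_left using fS by simp
  finally have zero: "l * (\<Sum>A\<in>S. c A)\<^sup>2 + (\<Sum>A\<in>S. (card A - real l) * (c A)\<^sup>2) = 0" ..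
  have nn: "0 \<le> (card A - real l) * (c A)\<^sup>2" if "A \<in> S" for A
    using ge[OF that] by simp
  have "0 \<le> real l * (\<Sum>A\<in>S. c A)\<^sup>2" by simp
  moreover have "0 \<le> (\<Sum>A\<in>S. (card A - real l) * (c A)\<^sup>2)" using nn by (rule sum_nonneg)
  ultimately
  have "real l * (\<Sum>A\<in>S. c A)\<^sup>2 = 0" and "(\<Sum>A\<in>S. (card A - real l) * (c A)\<^sup>2) = 0"
    using zero by linarith+
  then have c0: "(\<Sum>A\<in>S. c A) = 0" and "\<And>A. A \<in> S \<Longrightarrow> (card A - real l) * (c A)\<^sup>2 = 0"
    using \<open>l > 0\<close> sum_nonneg_eq_0_iff[OF fS, of "\<lambda>A. (card A - real l) * (c A)\<^sup>2"] nn by auto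
  then have cl: "card A = l" if "A \<in> S" "c A \<noteq> 0" for A using that by fastforce
  obtain A where A: "A \<in> S" "c A \<noteq> 0" using nz by blast
  \<comment> \<open>The coefficients sum to zero, so a nonzero one cannot stand alone.\<close>
  have "\<exists>B\<in>S-{A}. c B \<noteq> 0"
  proof (rule ccontr)
    assume "\<not> ?thesis"
    then have "(\<Sum>A\<in>S. c A) = c A" using sum.remove[OF fS A(1), of c] by simp
    then show False using A c0 by simp
  qed
  then obtain B where B: "B \<in> S" "c B \<noteq> 0" "A \<noteq> B" by blast
  \<comment> \<open>All three sets have exactly \<open>l\<close> elements.\<close>
  have "A \<inter> B = A" "A \<inter> B = B"
    using card_subset_eq[OF fin, of A "A \<inter> B"] card_subset_eq[OF fin, of B "A \<inter> B"] A B l cl by auto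
  then show False using B by simp
qed

section \<open>Lines in a subspace and their number\<close>

text \<open>For a subspace \<open>S\<close> these are the points of its projective space;
  proportional generators are identified because their spans coincide.\<close>

definition lines_in :: "('a::field ^ 'n) set \<Rightarrow> ('a ^ 'n) set set" where
  "lines_in S = (\<lambda>v. vec.span {v}) ` (S - {0})"

text \<open>The scalar taking \<open>w\<close> to \<open>v\<close> is nonzero, hence invertible.
  Consequently two lines sharing a nonzero vector coincide.\<close>

lemma span_singleton_nonzero_eq_iff:
  fixes v w :: "'a::field ^ 'n"
  assumes "v \<noteq> 0"
  shows "vec.span {v} = vec.span {w} \<longleftrightarrow> v \<in> vec.span {w}"
proof
  assume "v \<in> vec.span {w}"
  then obtain c where c: "v = c *s w" by (auto simp: vec.span_singleton)
  with assms have "c \<noteq> 0" by auto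
  then have "w = inverse c *s v" using c by simp
  then have "w \<in> vec.span {v}" by (auto simp: vec.span_singleton)
  with \<open>v \<in> vec.span {w}\<close> show "vec.span {v} = vec.span {w}"
    by (intro antisym vec.span_minimal vec.subspace_span) auto
qed (metis vec.span_base singletonI)

lemma span_singleton_in_lines_in_iff:
  fixes S :: "('a::field ^ 'n) set"
  assumes "vec.subspace S" "v \<noteq> 0"
  shows "vec.span {v} \<in> lines_in S \<longleftrightarrow> v \<in> S"
proof
  assume "vec.span {v} \<in> lines_in S"
  then obtain w where w: "w \<in> S" "vec.span {v} = vec.span {w}" by (auto simp: lines_in_def)
  then have "v \<in> vec.span {w}" using span_singleton_nonzero_eq_iff assms by blast
  then show "v \<in> S" using vec.span_minimal[of "{w}" S] w assms by auto
qed (use assms in \<open>auto simp: lines_in_def\<close>)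

text \<open>The lines determine the nonzero vectors, and \<open>0\<close> lies in every subspace.
  Thus passing to lines preserves the size of the family.\<close>

lemma inj_on_lines_in: "inj_on lines_in {S. vec.subspace S}"
proof (rule inj_onI, clarify)
  fix S T :: "('a ^ 'n) set"
  assume S: "vec.subspace S" and T: "vec.subspace T" and eq: "lines_in S = lines_in T"
  have "v \<in> S \<longleftrightarrow> v \<in> T" for v
    using span_singleton_in_lines_in_iff[OF S, of v] span_singleton_in_lines_in_iff[OF T, of v]
      vec.subspace_0[OF S] vec.subspace_0[OF T] eq by (cases "v = 0") auto
  then show "S = T" by blast
qed

lemma lines_in_Int:
  assumes "vec.subspace S" "vec.subspace T"
  shows "lines_in (S \<inter> T) = lines_in S \<inter> lines_in T"
proof
  show "lines_in S \<inter> lines_in T \<subseteq> lines_in (S \<inter> T)"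
  proof
    fix L assume L: "L \<in> lines_in S \<inter> lines_in T"
    then obtain v where v: "L = vec.span {v}" "v \<noteq> 0" "v \<in> S" by (auto simp: lines_in_def)
    then have "v \<in> T" using L span_singleton_in_lines_in_iff[OF assms(2)] by auto
    with v show "L \<in> lines_in (S \<inter> T)" by (auto simp: lines_in_def)
  qed
qed (auto simp: lines_in_def)

lemma card_nonzero_of_line:
  fixes v :: "'a::{field,finite} ^ 'n"
  assumes "v \<noteq> 0"
  shows "card (vec.span {v} - {0}) = CARD('a) - 1"
proof -
  have "vec.span {v} - {0} = (\<lambda>c. c *s v) ` (UNIV - {0})"
    using assms by (auto simp: vec.span_singleton)
  moreover have "inj_on (\<lambda>c. c *s v) (UNIV - {0})"
    using assms by (intro inj_onI) simp
  ultimately show ?thesis by (simp add: card_image)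
qed

text \<open>Without \<open>0\<close>, the lines partition the nonzero vectors of \<open>S\<close>
  into classes of size \<open>CARD('a) - 1\<close>.\<close>

lemma card_lines_in:
  fixes S :: "('a::{field,finite} ^ 'n) set"
  assumes "vec.subspace S"
  shows "(CARD('a) - 1) * card (lines_in S) = card S - 1"
proof -
  let ?C = "(\<lambda>L. L - {0}) ` lines_in S"
  have disj: "L = M" if L: "L \<in> lines_in S" and M: "M \<in> lines_in S" and v: "v \<in> L" "v \<in> M" "v \<noteq> 0" for L M v
    proof -
    obtain x y where "L = vec.span {x}" "M = vec.span {y}" using L M by (auto simp: lines_in_def)
    then show ?thesis
      using v span_singleton_nonzero_eq_iff[of v x] span_singleton_nonzero_eq_iff[of v y] by simp
  qed
  have ne: "\<exists>v. v \<in> L \<and> v \<noteq> 0" if "L \<in> lines_in S" for L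
    using that vec.span_base by (auto simp: lines_in_def)
  have un: "\<Union>?C = S - {0}"
  proof
    show "\<Union>?C \<subseteq> S - {0}"
    proof
      fix v assume "v \<in> \<Union>?C"
      then obtain w where "w \<in> S" "v \<in> vec.span {w}" "v \<noteq> 0" by (auto simp: lines_in_def)
      then show "v \<in> S - {0}" using vec.span_minimal[OF _ assms, of "{w}"] by auto
    qed
    show "S - {0} \<subseteq> \<Union>?C"
    proof
      fix v assume "v \<in> S - {0}"
      moreover have "v \<in> vec.span {v}" by (simp add: vec.span_base)
      ultimately show "v \<in> \<Union>?C" by (auto simp: lines_in_def)
    qed
  qed
  \<comment> \<open>Deleting \<open>0\<close> merges no two lines, so counting classes counts
    lines.\<close>
  have "inj_on (\<lambda>L. L - {0}) (lines_in S)"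
  proof (rule inj_onI)
    fix L M assume "L \<in> lines_in S" "M \<in> lines_in S" "L - {0} = M - {0}"
    then show "L = M" using disj ne[of L] by blast
  qed
  then have "card ?C = card (lines_in S)" by (rule card_image)
  moreover have "(CARD('a) - 1) * card ?C = card (\<Union>?C)"
  proof (rule card_partition)
    show "finite ?C" "finite (\<Union>?C)" by auto
    show "card C = CARD('a) - 1" if "C \<in> ?C" for C
      using that card_nonzero_of_line by (auto simp: lines_in_def)
    show "C \<inter> D = {}" if "C \<in> ?C" "D \<in> ?C" "C \<noteq> D" for C D
      using that disj by blast
  qed
  ultimately show ?thesis
    unfolding un using vec.subspace_0[OF assms] by simp
qed

text \<open>A linear isomorphism is a bijection. This makes the number of lines depend on the
  dimension alone.\<close>

lemma card_eq_of_dim_eq: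
  fixes S T :: "('a::field ^ 'n) set"
  assumes "vec.subspace S" "vec.subspace T" "vec.dim S = vec.dim T"
  shows "card S = card T"
  using vec.subspace_isomorphism[OF assms] by (metis card_image)

lemma card_field_gt_1: "1 < CARD('a::{field,finite})"
  using card_mono[of "UNIV :: 'a set" "{0, 1}"] by simp

theorem theorem1p2:
  fixes q n k :: nat
    and F :: "('a::{field,finite} ^ 'n) set set"
  assumes "primepow q" and "CARD('a) = q"
    and "n > 0" and "CARD('n) = n"
    and "k > 0"
    and "F \<subseteq> sub"
    and "\<And>A B. A \<in> F \<Longrightarrow> B \<in> F \<Longrightarrow> A \<noteq> B \<Longrightarrow> vec.dim (A \<inter> B) = k"
  shows "real (card F) \<le> q_bracket q n"
proof -
  let ?X = "lines_in (UNIV :: ('a ^ 'n) set)"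
  have q: "1 < q" using card_field_gt_1[where 'a = 'a] assms(2) by simp
  have qX: "(q - 1) * card ?X = q ^ n - 1"
    using card_lines_in[of "UNIV :: ('a ^ 'n) set"] assms(2,4) by simp
  then have "real (q - 1) * card ?X = real (q ^ n - 1)"
    by (metis of_nat_mult)
  then have "(real q - 1) * card ?X = real q ^ n - 1"
    using q by (simp add: of_nat_diff)
  then have X: "real (card ?X) = q_bracket q n"
    using q by (simp add: q_bracket_def field_simps)
  have F: "vec.subspace A" if "A \<in> F" for A using assms(6) that by (auto simp: sub_def)
  have "card F \<le> card ?X"
  proof (cases "1 < card F")
    \<comment> \<open>With at most one subspace it suffices that some line exists, which follows
      from \<open>n > 0\<close>.\<close>
    case False
    have "1 < q ^ n" using q assms(3) by (rule one_less_power)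
    then have "card ?X \<noteq> 0" using qX by (intro notI) simp
    with False show ?thesis by linarith
  next
    case True
    have "inj_on lines_in F" by (rule inj_on_subset[OF inj_on_lines_in]) (use F in blast)
    then have cF: "card (lines_in ` F) = card F" by (rule card_image)
    \<comment> \<open>A reference pair: its number of common lines serves as the constant
      \<open>l\<close>.\<close>
    obtain A0 B0 where AB0: "A0 \<in> F" "B0 \<in> F" "A0 \<noteq> B0"
      using True card_le_Suc0_iff_eq[of F] by fastforce
    have sub_Int: "vec.subspace (A \<inter> B)" if "A \<in> F" "B \<in> F" for A B
      using F that vec.subspace_inter by blast
    have "card (lines_in ` F) \<le> card ?X"
    proof (rule nonuniform_fisher_inequality[where l = "card (lines_in (A0 \<inter> B0))"])
      show "finite ?X" by simp
      show "L \<subseteq> ?X" if "L \<in> lines_in ` F" for L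
        using that by (auto simp: lines_in_def)
      \<comment> \<open>Here \<open>k > 0\<close> enters: a nonzero common vector spans a common
        line, so \<open>l > 0\<close>.\<close>
      have "\<not> A0 \<inter> B0 \<subseteq> {0}"
        using assms(5,7) AB0 by (metis vec.dim_eq_0 less_irrefl)
      then have "lines_in (A0 \<inter> B0) \<noteq> {}" by (auto simp: lines_in_def)
      then show "0 < card (lines_in (A0 \<inter> B0))" by (simp add: card_gt_0_iff)
      show "1 < card (lines_in ` F)" using True cF by simp
      fix L M assume LM: "L \<in> lines_in ` F" "M \<in> lines_in ` F" "L \<noteq> M"
      then obtain A B where AB: "A \<in> F" "B \<in> F" "A \<noteq> B" "L = lines_in A" "M = lines_in B"
        by blast
      have "card (A \<inter> B) = card (A0 \<inter> B0)"
        using card_eq_of_dim_eq sub_Int AB AB0 assms(7) by metis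
      \<comment> \<open>The factor \<open>q - 1\<close> is positive and cancels afterwards.\<close>
      then have "(q - 1) * card (lines_in (A \<inter> B)) = (q - 1) * card (lines_in (A0 \<inter> B0))"
        using card_lines_in[OF sub_Int] AB AB0 assms(2) by metis
      then show "card (L \<inter> M) = card (lines_in (A0 \<inter> B0))"
        using q AB F by (simp add: lines_in_Int)
    qed
    then show ?thesis using cF by simp
  qed
  then show ?thesis using X by simp
qed

end
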